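(* Let $\mathbf{X}^*\in\mathbb{R}^{p\times p}$ be a symmetric positive semidefinite matrix of rank $r$, written $\mathbf{X}^*=\mathbf{Y}^*\mathbf{Y}^{*\top}$ with $\mathbf{Y}^*\in\mathbb{R}^{p\times r}_*$. Then $[\mathbf{Y}^*]$ is the unique Riemannian first-order stationary point of $$\min_{[\mathbf{Y}]\in\mathcal{M}}H([\mathbf{Y}]),\qquad H([\mathbf{Y}])=\tfrac12\|\mathbf{Y}\mathbf{Y}^\top-\mathbf{X}^*\|_F^2 .$$
   Context: Let $0<r\le p$ be integers. $\mathbb{R}^{p\times r}_*$ is the set of real $p\times r$ matrices of full column rank, $\mathbb{O}_r$ the orthogonal group, and $\mathcal{M}=\mathbb{R}^{p\times r}_*/\mathbb{O}_r$ the quotient manifold with points $[\mathbf{Y}]=\{\mathbf{Y}\mathbf{O}:\mathbf{O}\in\mathbb{O}_r\}$ and the Riemannian metric induced from the Euclidean metric $\mathrm{tr}(\eta^\top\theta)$ on $\mathbb{R}^{p\times r}_*$. A Riemannian first-order stationary point of $H$ is a point $[\mathbf{Y}]\in\mathcal{M}$ at which the Riemannian gradient vanishes; the horizontal lift of the Riemannian gradient is $\overline{\mathrm{grad}\,H([\mathbf{Y}])}=2(\mathbf{Y}\mathbf{Y}^\top-\mathbf{X}^* )\mathbf{Y}$. *)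

theory Defs
  imports "HOL-Analysis.Analysis"
begin

definition sym_psd :: "real^'n^'n \<Rightarrow> bool" where
  "sym_psd A \<longleftrightarrow> transpose A = A \<and> (\<forall>v. 0 \<le> v \<bullet> (A *v v))"

definition full_col_rank :: "(real^'r^'p) set" where
  "full_col_rank = {Y. rank Y = CARD('r)}"

definition orth_class :: "real^'r^'p \<Rightarrow> (real^'r^'p) set" where
  "orth_class Y = {Y ** Q | Q. orthogonal_matrix Q}"

definition quotient_manifold :: "(real^'r^'p) set set" where
  "quotient_manifold = orth_class ` full_col_rank"

definition frobenius_inner :: "real^'r^'p \<Rightarrow> real^'r^'p \<Rightarrow> real" where
  "frobenius_inner \<eta> \<theta> = trace (transpose \<eta> ** \<theta>)"

text \<open>The vertical space at Y is the tangent space at Y of the fibre through Y: the velocities of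
  curves that stay in the fibre. The horizontal space is its orthogonal complement.\<close>

definition vertical_space :: "real^'r^'p \<Rightarrow> (real^'r^'p) set" where
  "vertical_space Y = {\<eta>. \<exists>\<gamma>. \<gamma> 0 = Y \<and> (\<forall>t. \<gamma> t \<in> orth_class Y) \<and>
     (\<gamma> has_vector_derivative \<eta>) (at (0::real))}"

definition horizontal_space :: "real^'r^'p \<Rightarrow> (real^'r^'p) set" where
  "horizontal_space Y = {\<theta>. \<forall>\<eta>\<in>vertical_space Y. frobenius_inner \<eta> \<theta> = 0}"

text \<open>A tangent vector to the quotient at the point c is represented by its horizontal lifts: the
  function sends each representative Y in c to the horizontal lift at Y. The lifts at Y and
  at Y ** Q correspond by right multiplication with Q. Outside c the function is 0 by
  convention, so that equal tangent vectors are equal functions.\<close>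

definition tangent_space :: "(real^'r^'p) set \<Rightarrow> (real^'r^'p \<Rightarrow> real^'r^'p) set" where
  "tangent_space c = {\<xi>. (\<forall>Y\<in>c. \<xi> Y \<in> horizontal_space Y \<and>
       (\<forall>Q. orthogonal_matrix Q \<longrightarrow> \<xi> (Y ** Q) = \<xi> Y ** Q)) \<and>
     (\<forall>Y. Y \<notin> c \<longrightarrow> \<xi> Y = 0)}"

text \<open>The metric on the quotient is the metric of the horizontal lifts. It does not depend on the
  representative, so \<^const>\<open>the_elem\<close> is applied to a singleton.\<close>

definition quotient_metric ::
    "(real^'r^'p) set \<Rightarrow> (real^'r^'p \<Rightarrow> real^'r^'p) \<Rightarrow> (real^'r^'p \<Rightarrow> real^'r^'p) \<Rightarrow> real" where
  "quotient_metric c \<xi> \<zeta> = the_elem ((\<lambda>Y. frobenius_inner (\<xi> Y) (\<zeta> Y)) ` c)"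

text \<open>\<open>\<xi>\<close> is the Riemannian gradient of F at c if F is differentiable at c and
  \<open>\<langle>\<xi>, \<zeta>\<rangle> = dF(c)[\<zeta>]\<close> for every tangent vector \<open>\<zeta>\<close>. The differential of F is
  computed on horizontal lifts, as that of the lifted function; since the full-rank matrices are open,
  the derivative depends only on the values of F on the quotient manifold.\<close>

definition is_riemannian_gradient ::
    "((real^'r^'p) set \<Rightarrow> real) \<Rightarrow> (real^'r^'p) set \<Rightarrow> (real^'r^'p \<Rightarrow> real^'r^'p) \<Rightarrow> bool" where
  "is_riemannian_gradient F c \<xi> \<longleftrightarrow> \<xi> \<in> tangent_space c \<and>
     (\<forall>Y\<in>c. \<exists>D. ((\<lambda>Z. F (orth_class Z)) has_derivative D) (at Y) \<and>
        (\<forall>\<zeta>\<in>tangent_space c. quotient_metric c \<xi> \<zeta> = D (\<zeta> Y)))"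

definition riemannian_stationary :: "((real^'r^'p) set \<Rightarrow> real) \<Rightarrow> (real^'r^'p) set \<Rightarrow> bool" where
  "riemannian_stationary F c \<longleftrightarrow> c \<in> quotient_manifold \<and> is_riemannian_gradient F c (\<lambda>_. 0)"

text \<open>The objective on the quotient; it is independent of the representative. On matrix types
  \<^const>\<open>norm\<close> is the Frobenius norm.\<close>

definition objective :: "real^'p^'p \<Rightarrow> (real^'r^'p) set \<Rightarrow> real" where
  "objective X c = the_elem ((\<lambda>Y. 1/2 * (norm (Y ** transpose Y - X))\<^sup>2) ` c)"

lemma orth_class_self: "Y \<in> orth_class Y"
  unfolding orth_class_def
  by (intro CollectI exI[of _ "mat 1"]) (simp add: orthogonal_matrix_id)

lemma orth_mult_transpose:
  fixes Y :: "real^'r^'p"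
  assumes "Z \<in> orth_class Y"
  shows "Z ** transpose Z = Y ** transpose Y"
proof -
  obtain Q where Z: "Z = Y ** Q" and Q: "orthogonal_matrix Q"
    using assms by (auto simp: orth_class_def)
  have "Z ** transpose Z = Y ** (Q ** transpose Q) ** transpose Y"
    unfolding Z matrix_transpose_mul by (simp add: matrix_mul_assoc)
  also have "\<dots> = Y ** transpose Y"
    using Q by (simp add: orthogonal_matrix_def)
  finally show ?thesis .
qed

lemma the_elem_image_const:
  assumes "y \<in> c" "\<And>x. x \<in> c \<Longrightarrow> f x = f y"
  shows "the_elem (f ` c) = f y"
proof -
  have "f ` c = {f y}" using assms by blast
  then show ?thesis by simp
qed

lemma objective_orth_class:
  "objective X (orth_class Y) = 1/2 * (norm (Y ** transpose Y - X))\<^sup>2"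
  unfolding objective_def
  by (rule the_elem_image_const[OF orth_class_self]) (simp only: orth_mult_transpose)

lemma frobenius_inner_eq_inner: "frobenius_inner \<eta> \<theta> = \<eta> \<bullet> \<theta>"
proof -
  have "frobenius_inner \<eta> \<theta> = (\<Sum>j\<in>UNIV. \<Sum>i\<in>UNIV. \<eta>$i$j * \<theta>$i$j)"
    by (simp add: frobenius_inner_def trace_def matrix_matrix_mult_def transpose_def)
  also have "\<dots> = (\<Sum>i\<in>UNIV. \<Sum>j\<in>UNIV. \<eta>$i$j * \<theta>$i$j)"
    by (rule sum.swap)
  finally show ?thesis by (simp add: inner_vec_def)
qed

lemma inner_matrix_mult_left:
  fixes A :: "real^'n^'m" and B :: "real^'k^'n" and C :: "real^'k^'m"
  shows "(A ** B) \<bullet> C = B \<bullet> (transpose A ** C)"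
  unfolding frobenius_inner_eq_inner[symmetric] frobenius_inner_def
  by (simp add: matrix_transpose_mul matrix_mul_assoc)

lemma inner_transpose:
  fixes A B :: "real^'n^'m"
  shows "transpose A \<bullet> transpose B = A \<bullet> B"
proof -
  have "transpose A \<bullet> transpose B = (\<Sum>j\<in>UNIV. \<Sum>i\<in>UNIV. A$i$j * B$i$j)"
    by (simp add: inner_vec_def transpose_def)
  also have "\<dots> = (\<Sum>i\<in>UNIV. \<Sum>j\<in>UNIV. A$i$j * B$i$j)"
    by (rule sum.swap)
  finally show ?thesis by (simp add: inner_vec_def)
qed

lemma orth_inner:
  fixes A B :: "real^'r^'p"
  assumes "orthogonal_matrix Q"
  shows "(A ** Q) \<bullet> (B ** Q) = A \<bullet> B"
proof -
  have "(A ** Q) \<bullet> (B ** Q) = (transpose Q ** transpose A) \<bullet> (transpose Q ** transpose B)"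
    using inner_transpose[of "A ** Q" "B ** Q"] by (simp add: matrix_transpose_mul)
  also have "\<dots> = transpose A \<bullet> ((Q ** transpose Q) ** transpose B)"
    by (simp add: inner_matrix_mult_left matrix_mul_assoc)
  also have "\<dots> = A \<bullet> B"
    using assms by (simp add: orthogonal_matrix_def inner_transpose)
  finally show ?thesis .
qed

lemma quotient_metric_eq:
  assumes \<xi>: "\<xi> \<in> tangent_space (orth_class Y)" and \<zeta>: "\<zeta> \<in> tangent_space (orth_class Y)"
    and Z: "Z \<in> orth_class Y"
  shows "quotient_metric (orth_class Y) \<xi> \<zeta> = frobenius_inner (\<xi> Z) (\<zeta> Z)"
proof -
  have *: "frobenius_inner (\<xi> W) (\<zeta> W) = frobenius_inner (\<xi> Y) (\<zeta> Y)" if W: "W \<in> orth_class Y" for W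
  proof -
    obtain Q where "W = Y ** Q" "orthogonal_matrix Q"
      using W by (auto simp: orth_class_def)
    moreover have "\<xi> (Y ** Q) = \<xi> Y ** Q" "\<zeta> (Y ** Q) = \<zeta> Y ** Q" if "orthogonal_matrix Q" for Q
      using \<xi> \<zeta> that orth_class_self[of Y] by (auto simp: tangent_space_def)
    ultimately show ?thesis by (simp add: frobenius_inner_eq_inner orth_inner)
  qed
  have "quotient_metric (orth_class Y) \<xi> \<zeta> = frobenius_inner (\<xi> Y) (\<zeta> Y)"
    unfolding quotient_metric_def by (rule the_elem_image_const[OF orth_class_self]) (rule *)
  then show ?thesis by (simp only: *[OF Z])
qed

lemma riemannian_gradient_unique:
  assumes "is_riemannian_gradient F (orth_class Y) \<xi>" "is_riemannian_gradient F (orth_class Y) \<xi>'"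
  shows "\<xi> = \<xi>'"
proof
  fix Z
  let ?c = "orth_class Y"
  have T: "\<xi> \<in> tangent_space ?c" "\<xi>' \<in> tangent_space ?c"
    using assms by (auto simp: is_riemannian_gradient_def)
  show "\<xi> Z = \<xi>' Z"
  proof (cases "Z \<in> ?c")
    case False
    then show ?thesis using T by (simp add: tangent_space_def)
  next
    case Z: True
    obtain D D' where
      D: "((\<lambda>Z. F (orth_class Z)) has_derivative D) (at Z)"
        "\<And>\<zeta>. \<zeta> \<in> tangent_space ?c \<Longrightarrow> quotient_metric ?c \<xi> \<zeta> = D (\<zeta> Z)"
      and D': "((\<lambda>Z. F (orth_class Z)) has_derivative D') (at Z)"
        "\<And>\<zeta>. \<zeta> \<in> tangent_space ?c \<Longrightarrow> quotient_metric ?c \<xi>' \<zeta> = D' (\<zeta> Z)"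
      using assms Z unfolding is_riemannian_gradient_def by metis
    have "D = D'" using D(1) D'(1) by (rule has_derivative_unique)
    then have "\<xi> Z \<bullet> \<zeta> Z = \<xi>' Z \<bullet> \<zeta> Z" if "\<zeta> \<in> tangent_space ?c" for \<zeta>
      using D(2)[OF that] D'(2)[OF that] quotient_metric_eq[OF T(1) that Z]
        quotient_metric_eq[OF T(2) that Z] by (simp add: frobenius_inner_eq_inner)
    from this[OF T(1)] this[OF T(2)] have "(\<xi> Z - \<xi>' Z) \<bullet> (\<xi> Z - \<xi>' Z) = 0"
      by (simp add: inner_diff inner_commute)
    then show ?thesis by simp
  qed
qed

lemma bounded_bilinear_matrix_mult:
  "bounded_bilinear ((**) :: real^'n^'m \<Rightarrow> real^'k^'n \<Rightarrow> real^'k^'m)"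
proof -
  have "(A + B) ** C = A ** C + B ** C" for A B :: "real^'n^'m" and C :: "real^'k^'n"
    by (simp add: vec_eq_iff matrix_matrix_mult_def distrib_right sum.distrib)
  moreover have "A ** (k *\<^sub>R B) = k *\<^sub>R (A ** B)" for k and A :: "real^'n^'m" and B :: "real^'k^'n"
    by (simp only: scalar_matrix_assoc matrix_scalar_ac)
  ultimately show ?thesis
    unfolding bilinear_conv_bounded_bilinear[symmetric] bilinear_def
    by (intro conjI allI linearI) (simp_all only: matrix_add_ldistrib scalar_matrix_assoc)
qed

lemma bounded_linear_transpose: "bounded_linear (transpose :: real^'n^'m \<Rightarrow> real^'m^'n)"
  unfolding linear_conv_bounded_linear[symmetric]
  by (auto intro!: linearI simp: vec_eq_iff transpose_def)

lemma objective_lift_has_derivative: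
  fixes X :: "real^'p^'p" and Y :: "real^'r^'p"
  assumes "transpose X = X"
  shows "((\<lambda>Z. objective X (orth_class Z)) has_derivative
      (\<lambda>\<theta>. (2 *\<^sub>R ((Y ** transpose Y - X) ** Y)) \<bullet> \<theta>)) (at Y)"
proof -
  let ?A = "Y ** transpose Y - X"
  have A: "transpose ?A = ?A"
    using assms
    by (simp add: linear_diff[OF bounded_linear.linear[OF bounded_linear_transpose]]
        matrix_transpose_mul)
  have t: "((\<lambda>Z::real^'r^'p. transpose Z) has_derivative transpose) (at Y)"
    by (rule bounded_linear_imp_has_derivative[OF bounded_linear_transpose])
  have "((\<lambda>Z. Z ** transpose Z) has_derivative (\<lambda>\<theta>. Y ** transpose \<theta> + \<theta> ** transpose Y)) (at Y)"
    using bounded_bilinear.FDERIV[OF bounded_bilinear_matrix_mult has_derivative_ident t] .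
  then have g: "((\<lambda>Z. Z ** transpose Z - X) has_derivative (\<lambda>\<theta>. Y ** transpose \<theta> + \<theta> ** transpose Y)) (at Y)"
    using has_derivative_diff[OF _ has_derivative_const] by fastforce
  have "((\<lambda>Z. 1/2 * ((Z ** transpose Z - X) \<bullet> (Z ** transpose Z - X))) has_derivative
     (\<lambda>\<theta>. 1/2 * (?A \<bullet> (Y ** transpose \<theta> + \<theta> ** transpose Y) + (Y ** transpose \<theta> + \<theta> ** transpose Y) \<bullet> ?A))) (at Y)"
    by (rule has_derivative_mult_right[OF has_derivative_inner[OF g g]])
  moreover have "1/2 * (?A \<bullet> (Y ** transpose \<theta> + \<theta> ** transpose Y) + (Y ** transpose \<theta> + \<theta> ** transpose Y) \<bullet> ?A)
      = (2 *\<^sub>R (?A ** Y)) \<bullet> \<theta>" for \<theta>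
  proof -
    have "(Y ** transpose \<theta>) \<bullet> ?A = transpose \<theta> \<bullet> (transpose Y ** ?A)"
      by (rule inner_matrix_mult_left)
    also have "\<dots> = \<theta> \<bullet> (?A ** Y)"
      using inner_transpose[of \<theta> "?A ** Y"] by (simp add: matrix_transpose_mul A)
    finally have 1: "(Y ** transpose \<theta>) \<bullet> ?A = \<theta> \<bullet> (?A ** Y)" .
    have 2: "(\<theta> ** transpose Y) \<bullet> ?A = (Y ** transpose \<theta>) \<bullet> ?A"
      using inner_transpose[of "\<theta> ** transpose Y" ?A] by (simp add: matrix_transpose_mul A)
    show ?thesis using 1 2 by (simp add: inner_add inner_commute)
  qed
  ultimately show ?thesis
    by (simp add: objective_orth_class power2_norm_eq_inner)
qed

text \<open>The horizontal lift of the gradient of the objective is \<open>2 (Y Y\<^sup>T - X) Y\<close>.\<close>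

lemma objective_riemannian_gradient:
  fixes X :: "real^'p^'p" and Y :: "real^'r^'p"
  assumes "transpose X = X"
  shows "is_riemannian_gradient (objective X) (orth_class Y)
    (\<lambda>Z. if Z \<in> orth_class Y then 2 *\<^sub>R ((Z ** transpose Z - X) ** Z) else 0)"
    (is "is_riemannian_gradient _ ?c ?\<xi>")
proof -
  have horizontal: "2 *\<^sub>R ((Z ** transpose Z - X) ** Z) \<in> horizontal_space Z" for Z :: "real^'r^'p"
    unfolding horizontal_space_def
  proof (intro CollectI ballI)
    fix \<eta> assume "\<eta> \<in> vertical_space Z"
    then obtain \<gamma> :: "real \<Rightarrow> real^'r^'p" where \<gamma>: "\<gamma> 0 = Z" "\<And>t. \<gamma> t \<in> orth_class Z"
      "(\<gamma> has_vector_derivative \<eta>) (at 0)"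
      by (auto simp: vertical_space_def)
    have "((\<lambda>t. objective X (orth_class (\<gamma> t))) has_derivative
        (\<lambda>t. (2 *\<^sub>R ((Z ** transpose Z - X) ** Z)) \<bullet> (t *\<^sub>R \<eta>))) (at 0)"
      by (rule has_derivative_compose[OF \<gamma>(3)[unfolded has_vector_derivative_def],
          of "\<lambda>W. objective X (orth_class W)", unfolded \<gamma>(1),
          OF objective_lift_has_derivative[OF assms]])
    moreover have "objective X (orth_class (\<gamma> t)) = objective X (orth_class Z)" for t
      using orth_mult_transpose[OF \<gamma>(2)] by (simp add: objective_orth_class)
    ultimately have "((\<lambda>_. objective X (orth_class Z)) has_derivative
        (\<lambda>t. (2 *\<^sub>R ((Z ** transpose Z - X) ** Z)) \<bullet> (t *\<^sub>R \<eta>))) (at (0::real))"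
      by simp
    from has_derivative_unique[OF this has_derivative_const]
    have "(2 *\<^sub>R ((Z ** transpose Z - X) ** Z)) \<bullet> (1 *\<^sub>R \<eta>) = 0"
      by (rule fun_cong)
    then show "frobenius_inner \<eta> (2 *\<^sub>R ((Z ** transpose Z - X) ** Z)) = 0"
      by (simp add: frobenius_inner_eq_inner inner_commute)
  qed
  have closed: "Z ** Q \<in> ?c" if Z: "Z \<in> ?c" and Q: "orthogonal_matrix Q" for Z Q
  proof -
    obtain R where "Z = Y ** R" "orthogonal_matrix R"
      using Z unfolding orth_class_def by blast
    with Q show ?thesis
      unfolding orth_class_def
      by (intro CollectI exI[of _ "R ** Q"]) (simp add: matrix_mul_assoc orthogonal_matrix_mul)
  qed
  have equivariant: "2 *\<^sub>R ((Z ** Q ** transpose (Z ** Q) - X) ** (Z ** Q)) =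
      (2 *\<^sub>R ((Z ** transpose Z - X) ** Z)) ** Q" if "orthogonal_matrix Q"
    for Z :: "real^'r^'p" and Q :: "real^'r^'r"
  proof -
    have "Z ** Q \<in> orth_class Z" using that unfolding orth_class_def by blast
    then have "Z ** Q ** transpose (Z ** Q) = Z ** transpose Z" by (rule orth_mult_transpose)
    then show ?thesis
      by (simp only: matrix_mul_assoc bounded_bilinear.scaleR_left[OF bounded_bilinear_matrix_mult])
  qed
  have T: "?\<xi> \<in> tangent_space ?c"
    unfolding tangent_space_def
  proof (intro CollectI conjI ballI allI impI)
    fix Z assume Z: "Z \<in> ?c"
    show "?\<xi> Z \<in> horizontal_space Z" using Z horizontal by simp
    fix Q :: "real^'r^'r" assume Q: "orthogonal_matrix Q"
    show "?\<xi> (Z ** Q) = ?\<xi> Z ** Q"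
      unfolding if_P[OF Z] if_P[OF closed[OF Z Q]] by (rule equivariant[OF Q])
  next
    fix Z assume "Z \<notin> ?c"
    then show "?\<xi> Z = 0" by simp
  qed
  show ?thesis
    unfolding is_riemannian_gradient_def
  proof (intro conjI T ballI exI)
    fix Z assume Z: "Z \<in> ?c"
    show "((\<lambda>Z. objective X (orth_class Z)) has_derivative
      (\<lambda>\<theta>. (2 *\<^sub>R ((Z ** transpose Z - X) ** Z)) \<bullet> \<theta>)) (at Z)"
      by (rule objective_lift_has_derivative[OF assms])
    fix \<zeta> assume "\<zeta> \<in> tangent_space ?c"
    from quotient_metric_eq[OF T this Z] Z
    show "quotient_metric ?c ?\<xi> \<zeta> = (2 *\<^sub>R ((Z ** transpose Z - X) ** Z)) \<bullet> \<zeta> Z"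
      by (simp add: frobenius_inner_eq_inner)
  qed
qed

end

theory Submission
  imports Defs
begin

text \<open>Stationarity of \<open>[Y]\<close> means \<open>Y Y\<^sup>T Y = X Y\<close>. As \<open>Y\<^sup>T Y\<close> is invertible, the columns of
  \<open>Y\<close> lie in the range of \<open>X = Ystar Ystar\<^sup>T\<close>, so \<open>Y = Ystar Q\<close> with \<open>Q\<close> square. Cancelling
  \<open>Ystar\<close>, \<open>Q\<close> and \<open>Ystar\<^sup>T Ystar\<close> from the stationarity equation leaves \<open>Q Q\<^sup>T = I\<close>.\<close>

lemma full_col_rank_left_inverse:
  fixes Y :: "real^'r^'p"
  assumes "Y \<in> full_col_rank"
  obtains L where "L ** Y = mat 1"
  using assms full_rank_injective[of Y] matrix_left_invertible_injective[of Y]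
  by (auto simp: full_col_rank_def)

text \<open>The quadratic form of the Gram matrix at \<open>x\<close> is the squared norm of
  \<open>Y *v x\<close>, so its kernel is that of \<open>Y\<close>, which is trivial. Being square,
  the Gram matrix is then invertible on both sides.\<close>

lemma gram_right_inverse:
  fixes Y :: "real^'r^'p"
  assumes "Y \<in> full_col_rank"
  obtains M where "transpose Y ** Y ** M = mat 1"
proof -
  obtain L where L: "L ** Y = mat 1"
    using assms by (rule full_col_rank_left_inverse)
  have "x = 0" if "(transpose Y ** Y) *v x = 0" for x
  proof -
    have "(Y *v x) \<bullet> (Y *v x) = x \<bullet> ((transpose Y ** Y) *v x)"
      by (simp add: dot_lmul_matrix[symmetric] matrix_vector_mul_assoc[symmetric]
          vector_transpose_matrix inner_commute)
    then have "Y *v x = 0" using that by simp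
    then have "(L ** Y) *v x = 0" by (simp add: matrix_vector_mul_assoc[symmetric])
    then show "x = 0" by (simp add: L)
  qed
  then obtain M where "M ** (transpose Y ** Y) = mat 1"
    using matrix_left_invertible_ker[of "transpose Y ** Y"] by blast
  then show thesis using that matrix_left_right_inverse by blast
qed

lemma orth_class_mult:
  fixes Y :: "real^'r^'p"
  assumes Q: "orthogonal_matrix Q"
  shows "orth_class (Y ** Q) = orth_class Y"
proof (intro equalityI subsetI)
  fix Z assume "Z \<in> orth_class (Y ** Q)"
  then obtain R where "Z = Y ** (Q ** R)" "orthogonal_matrix R"
    by (auto simp: orth_class_def matrix_mul_assoc)
  then show "Z \<in> orth_class Y"
    unfolding orth_class_def using Q orthogonal_matrix_mul by blast
next
  fix Z assume "Z \<in> orth_class Y"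
  then obtain R where R: "Z = Y ** R" "orthogonal_matrix R"
    by (auto simp: orth_class_def)
  have "Y ** Q ** (transpose Q ** R) = Y ** (Q ** transpose Q) ** R"
    by (simp add: matrix_mul_assoc)
  also have "\<dots> = Z"
    using Q R by (simp add: orthogonal_matrix_def)
  finally have "Z = Y ** Q ** (transpose Q ** R)" by simp
  moreover have "orthogonal_matrix (transpose Q ** R)"
    using Q R by (simp add: orthogonal_matrix_mul orthogonal_matrix_transpose)
  ultimately show "Z \<in> orth_class (Y ** Q)"
    unfolding orth_class_def by blast
qed

text \<open>Gradients are unique, so the zero field is one exactly when the explicit lift
  \<open>?\<xi>\<close> vanishes on the whole fibre; a single representative decides this.\<close>

lemma riemannian_stationary_objective_iff:
  fixes X :: "real^'p^'p" and Y :: "real^'r^'p"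
  assumes X: "transpose X = X" and Y: "Y \<in> full_col_rank"
  shows "riemannian_stationary (objective X) (orth_class Y) \<longleftrightarrow> Y ** transpose Y ** Y = X ** Y"
proof -
  let ?\<xi> = "\<lambda>Z. if Z \<in> orth_class Y then 2 *\<^sub>R ((Z ** transpose Z - X) ** Z) else 0"
  note grad = objective_riemannian_gradient[OF X, of Y]
  have expand: "(Z ** transpose Z - X) ** Z = Z ** transpose Z ** Z - X ** Z" for Z :: "real^'r^'p"
    by (rule bounded_bilinear.diff_left[OF bounded_bilinear_matrix_mult])
  have "riemannian_stationary (objective X) (orth_class Y) \<longleftrightarrow> ?\<xi> = (\<lambda>_. 0)"
  proof -
    have "orth_class Y \<in> quotient_manifold"
      using Y by (simp add: quotient_manifold_def)
    moreover have "is_riemannian_gradient (objective X) (orth_class Y) (\<lambda>_. 0) \<longleftrightarrow> ?\<xi> = (\<lambda>_. 0)"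
    proof
      assume "is_riemannian_gradient (objective X) (orth_class Y) (\<lambda>_. 0)"
      with grad show "?\<xi> = (\<lambda>_. 0)" by (rule riemannian_gradient_unique)
    next
      assume "?\<xi> = (\<lambda>_. 0)"
      with grad show "is_riemannian_gradient (objective X) (orth_class Y) (\<lambda>_. 0)" by (rule back_subst)
    qed
    ultimately show ?thesis by (simp only: riemannian_stationary_def simp_thms)
  qed
  also have "\<dots> \<longleftrightarrow> Y ** transpose Y ** Y = X ** Y"
  proof
    assume "?\<xi> = (\<lambda>_. 0)"
    from fun_cong[OF this, of Y] show "Y ** transpose Y ** Y = X ** Y"
      by (simp add: orth_class_self expand)
  next
    \<comment> \<open>All \<open>Z = Y ** Q\<close> in the fibre share the product
      \<open>Z ** transpose Z\<close>, so their equation is the one at \<open>Y\<close> multiplied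
      on the right by \<open>Q\<close>.\<close>
    assume eq: "Y ** transpose Y ** Y = X ** Y"
    have "(Z ** transpose Z - X) ** Z = 0" if Z: "Z \<in> orth_class Y" for Z
    proof -
      obtain Q where Q: "Z = Y ** Q"
        using Z by (auto simp: orth_class_def)
      have "Z ** transpose Z ** Z = Y ** transpose Y ** Y ** Q"
        unfolding orth_mult_transpose[OF Z] by (simp add: Q matrix_mul_assoc)
      also have "\<dots> = X ** Z"
        by (simp add: eq Q matrix_mul_assoc)
      finally show ?thesis by (simp add: expand)
    qed
    then show "?\<xi> = (\<lambda>_. 0)" by auto
  qed
  finally show ?thesis .
qed

lemma cubic_eq_imp_orth_factor:
  fixes Y S :: "real^'r^'p"
  assumes Y: "Y \<in> full_col_rank" and S: "S \<in> full_col_rank"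
    and eq: "Y ** transpose Y ** Y = S ** transpose S ** Y"
  obtains Q where "orthogonal_matrix Q" "Y = S ** Q"
proof -
  obtain M where M: "transpose Y ** Y ** M = mat 1"
    using Y by (rule gram_right_inverse)
  obtain N where N: "transpose S ** S ** N = mat 1"
    using S by (rule gram_right_inverse)
  obtain L where L: "L ** Y = mat 1"
    using Y by (rule full_col_rank_left_inverse)
  obtain K where K: "K ** S = mat 1"
    using S by (rule full_col_rank_left_inverse)
  \<comment> \<open>Multiplying \<open>eq\<close> on the right by \<open>M\<close> turns its left
    side into \<open>Y\<close> and its right side into \<open>S\<close> times this matrix.\<close>
  define Q where "Q = transpose S ** Y ** M"
  have "Y = Y ** (transpose Y ** Y ** M)" by (simp add: M)
  also have "\<dots> = Y ** transpose Y ** Y ** M" by (simp add: matrix_mul_assoc)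
  also have "\<dots> = S ** Q" by (simp add: eq Q_def matrix_mul_assoc)
  finally have YSQ: "Y = S ** Q" .
  \<comment> \<open>Since \<open>Q\<close> is square, the left inverse \<open>L ** S\<close> is
    two-sided, which lets \<open>S\<close> be recovered from \<open>Y\<close>.\<close>
  have "(L ** S) ** Q = mat 1" using L YSQ by (simp add: matrix_mul_assoc)
  then have Q_inv: "Q ** (L ** S) = mat 1" by (simp add: matrix_left_right_inverse)
  have "Y ** (L ** S) = S ** (Q ** (L ** S))" by (simp add: YSQ matrix_mul_assoc)
  then have YS: "Y ** (L ** S) = S" by (simp add: Q_inv)
  \<comment> \<open>Both inserted factors are identities; they supply the \<open>S\<close> and
    \<open>transpose S\<close> that complete \<open>Q ** transpose Q\<close> to
    \<open>Y ** transpose Y\<close>.\<close>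
  have "Q ** transpose Q = (K ** S) ** Q ** transpose Q ** (transpose S ** S ** N)"
    by (simp add: K N)
  also have "\<dots> = K ** (Y ** transpose Y) ** S ** N"
    by (simp add: YSQ matrix_transpose_mul matrix_mul_assoc)
  \<comment> \<open>Writing \<open>S\<close> as \<open>Y ** (L ** S)\<close> creates the cubic term
    to which \<open>eq\<close> applies.\<close>
  also have "\<dots> = K ** (Y ** transpose Y ** Y) ** (L ** S) ** N"
    using YS by (metis matrix_mul_assoc)
  also have "\<dots> = (K ** S) ** (transpose S ** (Y ** (L ** S)) ** N)"
    unfolding eq by (simp add: matrix_mul_assoc)
  also have "\<dots> = mat 1"
    by (simp add: K YS N)
  finally have "Q ** transpose Q = mat 1" .
  then have "orthogonal_matrix Q"
    by (simp add: orthogonal_matrix_def matrix_left_right_inverse)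
  with YSQ show thesis using that by blast
qed

lemma riemannian_stationary_objective_unique:
  fixes S :: "real^'r^'p"
  assumes S: "S \<in> full_col_rank"
  shows "riemannian_stationary (objective (S ** transpose S)) c \<longleftrightarrow> c = orth_class S"
proof
  have X: "transpose (S ** transpose S) = S ** transpose S"
    by (simp add: matrix_transpose_mul)
  \<comment> \<open>At \<open>Y = S\<close> the two sides of the stationarity equation
    coincide.\<close>
  show "riemannian_stationary (objective (S ** transpose S)) c" if "c = orth_class S"
    using riemannian_stationary_objective_iff[OF X S] that by simp
  assume c: "riemannian_stationary (objective (S ** transpose S)) c"
  then obtain Y where cY: "c = orth_class Y" and Y: "Y \<in> full_col_rank"
    by (auto simp: riemannian_stationary_def quotient_manifold_def)
  with c have "Y ** transpose Y ** Y = S ** transpose S ** Y"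
    by (simp only: riemannian_stationary_objective_iff[OF X])
  then obtain Q where "orthogonal_matrix Q" "Y = S ** Q"
    using cubic_eq_imp_orth_factor[OF Y S] by blast
  then show "c = orth_class S" by (simp add: cY orth_class_mult)
qed

theorem theorem8:
  fixes X :: "real^'p^'p" and Ystar :: "real^'r^'p"
  assumes "CARD('r) \<le> CARD('p)"
    and "sym_psd X"
    and "rank X = CARD('r)"
    and "Ystar \<in> full_col_rank"
    and "X = Ystar ** transpose Ystar"
  shows "{c :: (real^'r^'p) set. riemannian_stationary (objective X) c} = {orth_class Ystar}"
  using riemannian_stationary_objective_unique[OF assms(4)] assms(5) by blast

end
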